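(* Let $m,\sigma,L_0,L,y_0$ be real numbers with $m>0$, $\sigma>0$, $0<L_0<L$ and $y_0>0$. Let $P$ be the true period of oscillation, i.e. the (least positive) period of the solution $y(t)$ of $$\frac{d^2y}{dt^2}+\left(\frac{2\sigma}{m}\,\frac{\sqrt{L^2+y^2}-L_0}{\sqrt{L^2+y^2}}\right)y=0,\qquad y(0)=y_0,\quad \dot y(0)=0.$$ Then $$\frac{2\pi\sqrt{\frac{m}{2\sigma L_0}}}{\sqrt{\frac{1}{L_0}-\frac{1}{\sqrt{L^2+y_0^2}}}}\leq P\leq\frac{2\pi\sqrt{\frac{m}{2\sigma L_0}}}{\sqrt{\frac{1}{L_0}-\frac{2}{L+\sqrt{L^2+y_0^2}}}}.$$
   Context: Physical setting: a horizontal elastic wire of natural length $2L_0$ is stretched to length $2L$; a body of mass $m$ is tied to its center and moves on the vertical line through the center, with vertical displacement $y(t)$. Each half of the wire exerts a tension of magnitude $\sigma(\sqrt{L^2+y^2}-L_0)$, where $\sigma$ is the spring constant; there is no gravity and no damping. Newton's law gives the nonlinear differential equation in the claim; the body starts from rest at displacement $y_0$. *)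

theory Defs
  imports "HOL-Analysis.Analysis" "HOL-Library.Periodic_Fun"
begin

(* Solutions are taken on the whole real line; v and a are the velocity y' and
   the acceleration y''. *)
definition wire_solution ::
    "real \<Rightarrow> real \<Rightarrow> real \<Rightarrow> real \<Rightarrow> real \<Rightarrow> (real \<Rightarrow> real) \<Rightarrow> bool" where
  "wire_solution m \<sigma> L\<^sub>0 L y\<^sub>0 y \<longleftrightarrow>
     (\<exists>v a. (\<forall>t. (y has_real_derivative v t) (at t)) \<and>
            (\<forall>t. (v has_real_derivative a t) (at t)) \<and>
            (\<forall>t. a t + (2 * \<sigma> / m * ((sqrt (L\<^sup>2 + (y t)\<^sup>2) - L\<^sub>0) / sqrt (L\<^sup>2 + (y t)\<^sup>2))) * y t = 0) \<and>
            y 0 = y\<^sub>0 \<and> v 0 = 0)"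

definition is_least_period :: "(real \<Rightarrow> real) \<Rightarrow> real \<Rightarrow> bool" where
  "is_least_period f P \<longleftrightarrow>
     P > 0 \<and> periodic_fun_simple f P \<and> (\<forall>T>0. periodic_fun_simple f T \<longrightarrow> P \<le> T)"

end

theory Submission
  imports Defs
begin

text \<open>Write \<open>k = 2 \<sigma> / m\<close>, \<open>S = sqrt (L\<^sup>2 + y\<^sup>2)\<close> and \<open>S\<^sub>0 = sqrt (L\<^sup>2 + y\<^sub>0\<^sup>2)\<close>.
  Conservation of energy (\<open>wire_energy\<close>) gives
  \<open>v\<^sup>2 = k ((y\<^sub>0\<^sup>2 - y\<^sup>2) - 2 L\<^sub>0 (S\<^sub>0 - S)) = (y\<^sub>0\<^sup>2 - y\<^sup>2) * k (1 - 2 L\<^sub>0 / (S\<^sub>0 + S))\<close>,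
  because \<open>S\<^sub>0\<^sup>2 - S\<^sup>2 = y\<^sub>0\<^sup>2 - y\<^sup>2\<close>. Since \<open>L \<le> S \<le> S\<^sub>0\<close>, the last factor lies between
  \<open>\<alpha>\<^sup>2 = k (1 - 2 L\<^sub>0 / (L + S\<^sub>0))\<close> and \<open>\<beta>\<^sup>2 = k (1 - L\<^sub>0 / S\<^sub>0)\<close>. On the first descent from
  \<open>y\<^sub>0\<close> to \<open>0\<close>, the phase \<open>arccos (y / y\<^sub>0)\<close> grows from \<open>0\<close> to \<open>\<pi>/2\<close> with speed
  \<open>- v / sqrt (y\<^sub>0\<^sup>2 - y\<^sup>2)\<close>, that is, with speed between \<open>\<alpha>\<close> and \<open>\<beta>\<close>
  (\<open>arccos_growth\<close>). So the first zero \<open>T\<close> of \<open>y\<close> exists and satisfies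
  \<open>\<alpha> T \<le> \<pi>/2 \<le> \<beta> T\<close> (\<open>first_zero\<close>).

  It remains to see that the least period is \<open>4 T\<close> (\<open>least_period_quarters\<close>). The force is odd
  and globally Lipschitz, so solutions are determined by position and velocity at one time
  (\<open>newton_unique\<close>). Hence \<open>y\<close> is even about its rest time \<open>0\<close> and antisymmetric about its zero
  \<open>T\<close>; together, \<open>y (t + 2 T) = - y t\<close>. These symmetries also show that \<open>y < y\<^sub>0\<close> strictly
  between \<open>0\<close> and \<open>4 T\<close>, so no smaller period is possible. The bounds
  \<open>2 \<pi> / \<beta> \<le> 4 T \<le> 2 \<pi> / \<alpha>\<close> are the claim.\<close>

section \<open>Uniqueness and symmetry for an autonomous second order equation\<close>

text \<open>A Gronwall estimate: the squared phase-space distance \<open>E\<close> of two solutions satisfies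
  \<open>E' \<le> (1 + C) E\<close>.\<close>

lemma newton_unique_forward:
  fixes f y v z w :: "real \<Rightarrow> real"
  assumes lip: "\<And>p q. \<bar>f p - f q\<bar> \<le> C * \<bar>p - q\<bar>"
    and y: "\<And>t. (y has_real_derivative v t) (at t)" "\<And>t. (v has_real_derivative f (y t)) (at t)"
    and z: "\<And>t. (z has_real_derivative w t) (at t)" "\<And>t. (w has_real_derivative f (z t)) (at t)"
    and eq: "y s = z s" "v s = w s"
    and "s \<le> t"
  shows "y t = z t"
proof -
  define E where "E t = (y t - z t)\<^sup>2 + (v t - w t)\<^sup>2" for t
  define G where "G t = E t * exp (- (1 + C) * t)" for t
  have E': "(E has_real_derivative
      2 * (y t - z t) * (v t - w t) + 2 * (v t - w t) * (f (y t) - f (z t))) (at t)" for t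
    unfolding E_def by (rule derivative_eq_intros y z refl | simp add: algebra_simps)+
  have bound: "2 * (y t - z t) * (v t - w t) + 2 * (v t - w t) * (f (y t) - f (z t))
      \<le> (1 + C) * E t" for t
  proof -
    define p q r where "p = y t - z t" and "q = v t - w t" and "r = f (y t) - f (z t)"
    have r: "\<bar>r\<bar> \<le> C * \<bar>p\<bar>" using lip by (simp add: p_def r_def)
    have "0 \<le> C" using lip[of 1 0] by (simp add: abs_le_iff)
    have "q * r \<le> \<bar>q\<bar> * \<bar>r\<bar>" by (metis abs_ge_self abs_mult)
    also have "\<dots> \<le> \<bar>q\<bar> * (C * \<bar>p\<bar>)" using r by (intro mult_left_mono) auto
    finally have 1: "q * r \<le> C * (\<bar>p\<bar> * \<bar>q\<bar>)" by (simp add: algebra_simps)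
    have 2: "p * q \<le> \<bar>p\<bar> * \<bar>q\<bar>" by (metis abs_ge_self abs_mult)
    have 3: "2 * (\<bar>p\<bar> * \<bar>q\<bar>) \<le> p\<^sup>2 + q\<^sup>2"
      using sum_squares_bound[of "\<bar>p\<bar>" "\<bar>q\<bar>"] by (simp add: algebra_simps)
    have "2 * p * q + 2 * q * r \<le> (1 + C) * (2 * (\<bar>p\<bar> * \<bar>q\<bar>))"
      using 1 2 by (simp add: algebra_simps)
    also have "\<dots> \<le> (1 + C) * (p\<^sup>2 + q\<^sup>2)" using 3 \<open>0 \<le> C\<close> by (intro mult_left_mono) auto
    finally show ?thesis by (simp add: E_def p_def q_def r_def)
  qed
  have "G t \<le> G s"
  proof (rule DERIV_nonpos_imp_nonincreasing[OF \<open>s \<le> t\<close>])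
    fix x
    have "(G has_real_derivative
        ((2 * (y x - z x) * (v x - w x) + 2 * (v x - w x) * (f (y x) - f (z x))) - (1 + C) * E x)
          * exp (- (1 + C) * x)) (at x)"
      unfolding G_def by (rule derivative_eq_intros E' refl | simp add: algebra_simps)+
    moreover have "((2 * (y x - z x) * (v x - w x) + 2 * (v x - w x) * (f (y x) - f (z x)))
        - (1 + C) * E x) * exp (- (1 + C) * x) \<le> 0"
      using bound[of x] by (intro mult_nonpos_nonneg) auto
    ultimately show "\<exists>d. (G has_real_derivative d) (at x) \<and> d \<le> 0" by blast
  qed
  also have "G s = 0" by (simp add: G_def E_def eq)
  finally have "E t \<le> 0" by (simp add: G_def mult_le_0_iff)
  then show ?thesis unfolding E_def by (smt (verit) zero_le_power2 power2_eq_iff_nonneg zero_eq_power2)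
qed

text \<open>The force does not depend on time or velocity, so reversing time turns solutions into solutions.\<close>

lemma newton_reflect:
  fixes f y v :: "real \<Rightarrow> real"
  assumes "\<And>t. (y has_real_derivative v t) (at t)" "\<And>t. (v has_real_derivative f (y t)) (at t)"
  shows "((\<lambda>t. y (c - t)) has_real_derivative - v (c - t)) (at t)"
    and "((\<lambda>t. - v (c - t)) has_real_derivative f (y (c - t))) (at t)"
proof -
  have c: "((\<lambda>t. c - t) has_real_derivative - 1) (at t)"
    by (auto intro!: derivative_eq_intros)
  show "((\<lambda>t. y (c - t)) has_real_derivative - v (c - t)) (at t)"
    using DERIV_chain2[OF assms(1) c] by simp
  show "((\<lambda>t. - v (c - t)) has_real_derivative f (y (c - t))) (at t)"
    using DERIV_minus[OF DERIV_chain2[OF assms(2) c]] by simp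
qed

lemma newton_unique:
  fixes f y v z w :: "real \<Rightarrow> real"
  assumes lip: "\<And>p q. \<bar>f p - f q\<bar> \<le> C * \<bar>p - q\<bar>"
    and y: "\<And>t. (y has_real_derivative v t) (at t)" "\<And>t. (v has_real_derivative f (y t)) (at t)"
    and z: "\<And>t. (z has_real_derivative w t) (at t)" "\<And>t. (w has_real_derivative f (z t)) (at t)"
    and eq: "y s = z s" "v s = w s"
  shows "y t = z t"
proof (cases "s \<le> t")
  case True
  then show ?thesis using newton_unique_forward[OF lip y z eq] by blast
next
  case False
  have "y (0 - (- t)) = z (0 - (- t))"
    by (rule newton_unique_forward[OF lip newton_reflect[OF y] newton_reflect[OF z], of 0 "- s"])
      (use False eq in auto)
  then show ?thesis by simp
qed

lemma newton_rest_even: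
  fixes f y v :: "real \<Rightarrow> real"
  assumes lip: "\<And>p q. \<bar>f p - f q\<bar> \<le> C * \<bar>p - q\<bar>"
    and y: "\<And>t. (y has_real_derivative v t) (at t)" "\<And>t. (v has_real_derivative f (y t)) (at t)"
    and rest: "v 0 = 0"
  shows "y (- t) = y t"
  using newton_unique[OF lip newton_reflect[OF y, of 0] y, of 0 t] rest by simp

text \<open>For an odd force, \<open>- y\<close> is again a solution; at a zero \<open>T\<close> of \<open>y\<close> it has the same position
  and velocity as the reflection of \<open>y\<close> about \<open>T\<close>.\<close>

lemma newton_zero_antisym:
  fixes f y v :: "real \<Rightarrow> real"
  assumes lip: "\<And>p q. \<bar>f p - f q\<bar> \<le> C * \<bar>p - q\<bar>"
    and odd: "\<And>x. f (- x) = - f x"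
    and y: "\<And>t. (y has_real_derivative v t) (at t)" "\<And>t. (v has_real_derivative f (y t)) (at t)"
    and zero: "y T = 0"
  shows "y (2 * T - t) = - y t"
proof -
  have d: "((\<lambda>t. - y t) has_real_derivative - v t) (at t)"
       "((\<lambda>t. - v t) has_real_derivative f (- y t)) (at t)" for t
    unfolding odd by (intro DERIV_minus y)+
  show ?thesis
    using newton_unique[OF lip newton_reflect[OF y, of "2 * T"] d, of T t] zero by simp
qed

section \<open>The first quarter of the oscillation\<close>

text \<open>As long as the body has not crossed the origin, its phase \<open>arccos (y / A)\<close> moves with speed
  \<open>sqrt (H y)\<close>. The arccosine is not differentiable at the starting value \<open>1\<close>, so the mean value
  theorem is applied with differentiability in the open interval only.\<close>

lemma arccos_growth:
  fixes f y v H :: "real \<Rightarrow> real"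
  assumes y: "\<And>t. (y has_real_derivative v t) (at t)" "\<And>t. (v has_real_derivative f (y t)) (at t)"
    and init: "y 0 = A" "v 0 = 0" and "A > 0"
    and neg: "\<And>x. x > 0 \<Longrightarrow> f x < 0"
    and energy: "\<And>t. (v t)\<^sup>2 = (A\<^sup>2 - (y t)\<^sup>2) * H (y t)"
    and H: "\<And>x. 0 \<le> x \<Longrightarrow> x \<le> A \<Longrightarrow> \<alpha>\<^sup>2 \<le> H x \<and> H x \<le> \<beta>\<^sup>2"
    and "0 < \<alpha>" "0 < \<beta>"
    and "0 < t" and pos: "\<And>s. 0 \<le> s \<Longrightarrow> s < t \<Longrightarrow> 0 < y s"
  shows "y t < A" and "\<alpha> * t \<le> arccos (y t / A)" and "arccos (y t / A) \<le> \<beta> * t"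
proof -
  have cont: "isCont y s" for s using y(1) DERIV_isCont by blast
  have contv: "isCont v s" for s using y(2) DERIV_isCont by blast
  \<comment> \<open>The force points to the origin, so the velocity decreases from its initial value \<open>0\<close>.\<close>
  have vneg: "v s < 0" if "0 < s" "s < t" for s
  proof -
    have "v s < v 0"
      by (rule DERIV_neg_imp_decreasing_open[OF \<open>0 < s\<close>])
        (use that y(2) pos neg contv in \<open>auto intro!: continuous_at_imp_continuous_on exI\<close>)
    then show ?thesis by (simp add: init)
  qed
  have less: "y s < A" if "0 < s" "s \<le> t" for s
  proof -
    have "y s < y 0"
      by (rule DERIV_neg_imp_decreasing_open[OF \<open>0 < s\<close>])
        (use that y(1) vneg cont in \<open>auto intro!: continuous_at_imp_continuous_on exI\<close>)
    then show ?thesis by (simp add: init)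
  qed
  show "y t < A" using less \<open>0 < t\<close> by simp
  have nonneg: "0 \<le> y s" if "0 \<le> s" "s \<le> t" for s
  proof (cases "s = t")
    case True
    show ?thesis
    proof (rule ccontr)
      assume "\<not> 0 \<le> y s"
      then have "y t < 0" using True by simp
      then have "\<exists>x\<ge>0. x \<le> t \<and> y x = y t / 2"
        using init \<open>A > 0\<close> \<open>0 < t\<close> cont by (intro IVT2) auto
      then obtain x where "0 \<le> x" "x \<le> t" "y x = y t / 2" by blast
      then show False using pos[of x] \<open>y t < 0\<close> by (cases "x = t") auto
    qed
  qed (use that pos[of s] in auto)
  define \<theta> where "\<theta> s = arccos (y s / A)" for s
  have bounds: "-1 \<le> y s / A \<and> y s / A \<le> 1" if "0 \<le> s" "s \<le> t" for s
    using nonneg[OF that] less[of s] that \<open>A > 0\<close> init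
    by (cases "s = 0") (auto simp: field_simps)
  have "continuous_on {0..t} \<theta>"
    unfolding \<theta>_def using bounds \<open>A > 0\<close>
    by (intro continuous_on_arccos continuous_intros continuous_at_imp_continuous_on ballI cont) auto
  moreover have \<theta>': "(\<theta> has_real_derivative - v s / sqrt (A\<^sup>2 - (y s)\<^sup>2)) (at s)"
    if "0 < s" "s < t" for s
  proof -
    have "(\<theta> has_real_derivative (v s / A) * inverse (- sqrt (1 - (y s / A)\<^sup>2))) (at s)"
      unfolding \<theta>_def
      by (rule derivative_eq_intros y(1) refl | use that pos[of s] less[of s] \<open>A > 0\<close> in \<open>simp add: field_simps\<close>)+
    moreover have "A\<^sup>2 - (y s)\<^sup>2 = A\<^sup>2 * (1 - (y s / A)\<^sup>2)"
      using \<open>A > 0\<close> by (simp add: field_simps)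
    then have "sqrt (A\<^sup>2 - (y s)\<^sup>2) = A * sqrt (1 - (y s / A)\<^sup>2)"
      using \<open>A > 0\<close> by (simp add: real_sqrt_mult)
    ultimately show ?thesis by (simp add: divide_inverse algebra_simps)
  qed
  ultimately obtain l s where s: "0 < s" "s < t" "(\<theta> has_real_derivative l) (at s)"
      "\<theta> t - \<theta> 0 = (t - 0) * l"
    using MVT[OF \<open>0 < t\<close>, of \<theta>] by (metis real_differentiable_def)
  have l: "l = - v s / sqrt (A\<^sup>2 - (y s)\<^sup>2)" using DERIV_unique \<theta>' s by blast
  have "0 < y s" "y s < A" using pos less s by auto
  then have D: "0 < A\<^sup>2 - (y s)\<^sup>2" by (simp add: power_strict_mono)
  have "l\<^sup>2 = H (y s)" using D by (simp add: l power_divide energy)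
  moreover have "0 < l" using vneg[of s] s D by (simp add: l divide_neg_pos)
  ultimately have "\<alpha> \<le> l" "l \<le> \<beta>"
    using H[of "y s"] \<open>0 < y s\<close> \<open>y s < A\<close> \<open>0 < \<alpha>\<close> \<open>0 < \<beta>\<close> by (auto intro: power2_le_imp_le)
  moreover have "\<theta> t = l * t" using s(4) \<open>A > 0\<close> by (simp add: \<theta>_def init)
  ultimately show "\<alpha> * t \<le> arccos (y t / A)" "arccos (y t / A) \<le> \<beta> * t"
    using \<open>0 < t\<close> by (auto simp: \<theta>_def)
qed

text \<open>The phase never exceeds \<open>\<pi>/2\<close> while \<open>y\<close> is positive and grows at rate at least \<open>\<alpha>\<close>, so \<open>y\<close>
  cannot stay positive beyond time \<open>\<pi> / (2 \<alpha>)\<close>.\<close>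

lemma first_zero:
  fixes f y v H :: "real \<Rightarrow> real"
  assumes y: "\<And>t. (y has_real_derivative v t) (at t)" "\<And>t. (v has_real_derivative f (y t)) (at t)"
    and init: "y 0 = A" "v 0 = 0" and "A > 0"
    and neg: "\<And>x. x > 0 \<Longrightarrow> f x < 0"
    and energy: "\<And>t. (v t)\<^sup>2 = (A\<^sup>2 - (y t)\<^sup>2) * H (y t)"
    and H: "\<And>x. 0 \<le> x \<Longrightarrow> x \<le> A \<Longrightarrow> \<alpha>\<^sup>2 \<le> H x \<and> H x \<le> \<beta>\<^sup>2"
    and "0 < \<alpha>" "0 < \<beta>"
  obtains T where "0 < T" "y T = 0" "\<And>s. 0 \<le> s \<Longrightarrow> s < T \<Longrightarrow> 0 < y s"
    "\<And>s. 0 < s \<Longrightarrow> s \<le> T \<Longrightarrow> y s < A" "\<alpha> * T \<le> pi / 2" "pi / 2 \<le> \<beta> * T"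
proof -
  have growth: "y t < A" "\<alpha> * t \<le> arccos (y t / A)" "arccos (y t / A) \<le> \<beta> * t"
    if "0 < t" "\<And>s. 0 \<le> s \<Longrightarrow> s < t \<Longrightarrow> 0 < y s" for t
    using arccos_growth[of y v f A H \<alpha> \<beta> t, OF y init \<open>A > 0\<close> neg energy H \<open>0 < \<alpha>\<close> \<open>0 < \<beta>\<close> that]
    by blast+
  have cont: "isCont y s" for s using y(1) DERIV_isCont by blast
  define Z where "Z = {0..} \<inter> y -` {..0}"
  have Z: "s \<in> Z \<longleftrightarrow> 0 \<le> s \<and> y s \<le> 0" for s by (auto simp: Z_def)
  have "Z \<noteq> {}"
  proof
    assume "Z = {}"
    then have pos: "0 < y s" if "0 \<le> s" for s using Z that by (metis empty_iff not_less)
    define t where "t = pi / (2 * \<alpha>)"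
    have "0 < t" using \<open>0 < \<alpha>\<close> by (simp add: t_def)
    have "pi / 2 \<le> arccos (y t / A)"
      using growth(2)[OF \<open>0 < t\<close>] pos \<open>0 < \<alpha>\<close> by (simp add: t_def)
    moreover have "arccos (y t / A) < arccos 0"
      using growth(1)[OF \<open>0 < t\<close>] pos \<open>0 < t\<close> \<open>A > 0\<close> by (intro arccos_less_arccos) auto
    ultimately show False by simp
  qed
  moreover have "closed Z" unfolding Z_def
    using cont by (intro closed_Int closed_vimage_Int continuous_closed_vimage) auto
  moreover have bdd: "bdd_below Z" by (auto simp: Z_def)
  ultimately have mem: "Inf Z \<in> Z" by (intro closed_contains_Inf)
  define T where "T = Inf Z"
  have T: "0 \<le> T" "y T \<le> 0" using mem Z by (auto simp: T_def)
  have "0 < T" using T init \<open>A > 0\<close> by (cases "T = 0") auto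
  have pos: "0 < y s" if "0 \<le> s" "s < T" for s
    using that cInf_lower[OF _ bdd, of s] Z[of s] unfolding T_def by fastforce
  have "y T = 0"
  proof (rule ccontr)
    assume "y T \<noteq> 0"
    then have "y T < 0" using T by simp
    then have "\<exists>x\<ge>0. x \<le> T \<and> y x = y T / 2"
      using init \<open>A > 0\<close> T cont by (intro IVT2) auto
    then obtain x where "0 \<le> x" "x \<le> T" "y x = y T / 2" by blast
    then show False using pos[of x] \<open>y T < 0\<close> by (cases "x = T") auto
  qed
  show thesis
  proof (rule that[OF \<open>0 < T\<close> \<open>y T = 0\<close> pos])
    show "y s < A" if "0 < s" "s \<le> T" for s
      using growth(1)[OF that(1)] pos that by simp
    show "\<alpha> * T \<le> pi / 2" "pi / 2 \<le> \<beta> * T"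
      using growth(2,3)[OF \<open>0 < T\<close>] pos \<open>y T = 0\<close> by auto
  qed
qed

text \<open>A quarter oscillation, from \<open>A\<close> at time \<open>0\<close> down to the first zero at time \<open>T\<close>, determines
  the whole motion by the two symmetries.\<close>

lemma least_period_quarters:
  fixes f y v :: "real \<Rightarrow> real"
  assumes lip: "\<And>p q. \<bar>f p - f q\<bar> \<le> C * \<bar>p - q\<bar>"
    and odd: "\<And>x. f (- x) = - f x"
    and y: "\<And>t. (y has_real_derivative v t) (at t)" "\<And>t. (v has_real_derivative f (y t)) (at t)"
    and init: "y 0 = A" "v 0 = 0" and "A > 0"
    and T: "0 < T" "y T = 0"
    and pos: "\<And>s. 0 \<le> s \<Longrightarrow> s < T \<Longrightarrow> 0 < y s"
    and less: "\<And>s. 0 < s \<Longrightarrow> s \<le> T \<Longrightarrow> y s < A"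
    and P: "is_least_period y P"
  shows "P = 4 * T"
proof (rule antisym)
  have refl: "y (2 * T - t) = - y t" for t by (rule newton_zero_antisym[OF lip odd y T(2)])
  have half: "y (t + 2 * T) = - y t" for t
    using refl[of "- t"] newton_rest_even[OF lip y init(2), of t] by (simp add: add.commute)
  have "y (t + 4 * T) = y t" for t using half[of "t + 2 * T"] half[of t] by (simp add: add.assoc)
  then have "periodic_fun_simple y (4 * T)" by unfold_locales
  then show "P \<le> 4 * T" using P T(1) by (simp add: is_least_period_def)
  \<comment> \<open>The value \<open>A\<close> is not taken in \<open>(0, 2T]\<close> nor \<open>- A\<close> in \<open>[0, 2T)\<close>, so \<open>A\<close> does not recur
    before \<open>4T\<close>.\<close>
  have nonneg: "0 \<le> y s" if "0 \<le> s" "s \<le> T" for s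
    using pos[of s] that T(2) by (cases "s = T") auto
  have upper: "y s < A" if "0 < s" "s \<le> 2 * T" for s
    using less[of s] that refl[of s] nonneg[of "2 * T - s"] \<open>A > 0\<close> by (cases "s \<le> T") auto
  have lower: "- A < y s" if "0 \<le> s" "s < 2 * T" for s
    using less[of "2 * T - s"] that refl[of s] nonneg[of s] \<open>A > 0\<close> by (cases "s \<le> T") auto
  have "P > 0" and per: "periodic_fun_simple y P" using P by (auto simp: is_least_period_def)
  have "y (0 + P) = y 0" using per by (rule periodic_fun_simple.plus_period)
  then have "y P = A" by (simp add: init)
  show "4 * T \<le> P"
  proof (rule ccontr)
    assume "\<not> 4 * T \<le> P"
    then have "y P < A"
      using upper[of P] lower[of "P - 2 * T"] half[of "P - 2 * T"] \<open>P > 0\<close>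
      by (cases "P \<le> 2 * T") auto
    then show False using \<open>y P = A\<close> by simp
  qed
qed

section \<open>The elastic wire\<close>

text \<open>The acceleration at displacement \<open>x\<close>, with \<open>k\<close> standing for \<open>2 \<sigma> / m\<close>.\<close>

definition wire_accel :: "real \<Rightarrow> real \<Rightarrow> real \<Rightarrow> real \<Rightarrow> real" where
  "wire_accel k L\<^sub>0 L x = - (k * ((sqrt (L\<^sup>2 + x\<^sup>2) - L\<^sub>0) / sqrt (L\<^sup>2 + x\<^sup>2)) * x)"

lemma wire_accel_odd: "wire_accel k L\<^sub>0 L (- x) = - wire_accel k L\<^sub>0 L x"
  by (simp add: wire_accel_def)

lemma le_sqrt_sum_squares: "L \<le> sqrt (L\<^sup>2 + x\<^sup>2)" if "0 < (L::real)"
  by (rule real_le_rsqrt) simp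

lemma wire_accel_neg:
  assumes "0 < k" "0 < L\<^sub>0" "L\<^sub>0 < L" "0 < x"
  shows "wire_accel k L\<^sub>0 L x < 0"
proof -
  have "0 < sqrt (L\<^sup>2 + x\<^sup>2) - L\<^sub>0" "0 < sqrt (L\<^sup>2 + x\<^sup>2)"
    using assms le_sqrt_sum_squares[of L x] by linarith+
  then show ?thesis
    unfolding wire_accel_def using assms by (intro iffD2[OF neg_less_0_iff_less] mult_pos_pos divide_pos_pos)
qed

text \<open>The acceleration has derivative \<open>k (L\<^sub>0 L\<^sup>2 / S\<^sup>3 - 1)\<close> with \<open>S = sqrt (L\<^sup>2 + x\<^sup>2) \<ge> L > L\<^sub>0\<close>, which
  lies in \<open>[-k, 0]\<close>.\<close>

lemma wire_accel_lipschitz: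
  assumes "0 < k" "0 < L\<^sub>0" "L\<^sub>0 < L"
  shows "\<bar>wire_accel k L\<^sub>0 L p - wire_accel k L\<^sub>0 L q\<bar> \<le> k * \<bar>p - q\<bar>"
proof -
  define S where "S x = sqrt (L\<^sup>2 + x\<^sup>2)" for x
  have S: "L \<le> S x" for x using le_sqrt_sum_squares[of L x] assms by (simp add: S_def)
  have Spos: "0 < S x" for x using S[of x] assms by linarith
  have S2: "(S x)\<^sup>2 = L\<^sup>2 + x\<^sup>2" for x by (simp add: S_def)
  have S': "(S has_real_derivative x / S x) (at x)" for x
  proof -
    have "0 < L\<^sup>2 + x\<^sup>2" using assms by (simp add: add_pos_nonneg)
    then show ?thesis unfolding S_def
      by (auto intro!: derivative_eq_intros simp: field_simps)
  qed
  have eq: "wire_accel k L\<^sub>0 L = (\<lambda>x. k * (L\<^sub>0 * (x / S x) - x))"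
    using Spos unfolding wire_accel_def S_def[symmetric]
    by (intro ext) (simp add: field_simps less_imp_neq[symmetric])
  have "norm (wire_accel k L\<^sub>0 L p - wire_accel k L\<^sub>0 L q) \<le> k * norm (p - q)"
  proof (rule field_differentiable_bound[of UNIV])
    fix x
    have Sx: "S x \<noteq> 0" using Spos[of x] by simp
    have L2: "L\<^sup>2 = (S x)\<^sup>2 - x\<^sup>2" using S2[of x] by simp
    have deriv: "k * (L\<^sub>0 * ((S x - x * (x / S x)) / (S x * S x)) - 1) = k * (L\<^sub>0 * L\<^sup>2 / (S x)^3 - 1)"
      unfolding L2 using Sx by (simp add: field_simps power2_eq_square power3_eq_cube)
    show "(wire_accel k L\<^sub>0 L has_real_derivative k * (L\<^sub>0 * L\<^sup>2 / (S x)^3 - 1)) (at x within UNIV)"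
      unfolding eq deriv[symmetric]
      by (rule derivative_eq_intros S' refl Sx | simp)+
    have "L\<^sub>0 * L\<^sup>2 \<le> L * L\<^sup>2" using assms by (intro mult_right_mono) auto
    also have "\<dots> \<le> (S x)^3" using S[of x] assms power_mono[of L "S x" 3]
      by (simp add: power3_eq_cube power2_eq_square algebra_simps)
    finally have "0 \<le> L\<^sub>0 * L\<^sup>2 / (S x)^3" "L\<^sub>0 * L\<^sup>2 / (S x)^3 \<le> 1"
      using Spos[of x] assms by (auto simp: field_simps)
    then have "\<bar>L\<^sub>0 * L\<^sup>2 / (S x)^3 - 1\<bar> \<le> 1" by linarith
    then show "norm (k * (L\<^sub>0 * L\<^sup>2 / (S x)^3 - 1)) \<le> k"
      using assms by (simp add: abs_mult)
  qed auto
  then show ?thesis by simp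
qed

text \<open>Conservation of energy, with the factor \<open>A\<^sup>2 - y\<^sup>2\<close> of a harmonic oscillator split off.\<close>

lemma wire_energy:
  fixes y v :: "real \<Rightarrow> real"
  assumes "0 < L"
    and y: "\<And>t. (y has_real_derivative v t) (at t)"
      "\<And>t. (v has_real_derivative wire_accel k L\<^sub>0 L (y t)) (at t)"
    and init: "y 0 = A" "v 0 = 0"
  shows "(v t)\<^sup>2 = (A\<^sup>2 - (y t)\<^sup>2) *
    (k * (1 - 2 * L\<^sub>0 / (sqrt (L\<^sup>2 + A\<^sup>2) + sqrt (L\<^sup>2 + (y t)\<^sup>2))))"
proof -
  define S where "S x = sqrt (L\<^sup>2 + x\<^sup>2)" for x
  have Spos: "0 < S x" for x using le_sqrt_sum_squares[OF \<open>0 < L\<close>, of x] \<open>0 < L\<close> unfolding S_def by linarith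
  have S2: "(S x)\<^sup>2 = L\<^sup>2 + x\<^sup>2" for x by (simp add: S_def)
  define E where "E t = (v t)\<^sup>2 + k * ((y t)\<^sup>2 - 2 * L\<^sub>0 * S (y t))" for t
  have "(E has_real_derivative 0) (at s)" for s
  proof -
    have "0 < L\<^sup>2 + (y s)\<^sup>2" using assms by (simp add: add_pos_nonneg)
    then have Sd: "((\<lambda>t. S (y t)) has_real_derivative y s * v s / S (y s)) (at s)" unfolding S_def
      by (auto intro!: derivative_eq_intros y simp: field_simps)
    have "(E has_real_derivative 2 * v s * wire_accel k L\<^sub>0 L (y s)
        + k * (2 * y s * v s - 2 * L\<^sub>0 * (y s * v s / S (y s)))) (at s)"
      unfolding E_def by (rule derivative_eq_intros Sd y refl | simp)+
    moreover have "2 * v s * wire_accel k L\<^sub>0 L (y s)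
        + k * (2 * y s * v s - 2 * L\<^sub>0 * (y s * v s / S (y s))) = 0"
      using Spos[of "y s"] unfolding wire_accel_def S_def[symmetric] by (simp add: field_simps)
    ultimately show ?thesis by simp
  qed
  then have "E t = E 0" by (intro DERIV_isconst_all) auto
  then have v2: "(v t)\<^sup>2 = k * (A\<^sup>2 - (y t)\<^sup>2 - 2 * L\<^sub>0 * (S A - S (y t)))"
    by (simp add: E_def init algebra_simps)
  have "(S A - S (y t)) * (S A + S (y t)) = A\<^sup>2 - (y t)\<^sup>2"
    using S2[of A] S2[of "y t"] by (simp add: algebra_simps power2_eq_square)
  then have diff: "S A - S (y t) = (A\<^sup>2 - (y t)\<^sup>2) / (S A + S (y t))"
    using Spos[of A] Spos[of "y t"] by (simp add: field_simps)
  then show ?thesis unfolding v2 S_def[symmetric] diff by (simp add: algebra_simps)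
qed

theorem proposition1:
  fixes m \<sigma> L\<^sub>0 L y\<^sub>0 P :: real and y :: "real \<Rightarrow> real"
  assumes "m > 0" and "\<sigma> > 0" and "0 < L\<^sub>0" and "L\<^sub>0 < L" and "y\<^sub>0 > 0"
    and "wire_solution m \<sigma> L\<^sub>0 L y\<^sub>0 y"
    and "is_least_period y P"
  shows "2 * pi * sqrt (m / (2 * \<sigma> * L\<^sub>0)) / sqrt (1 / L\<^sub>0 - 1 / sqrt (L\<^sup>2 + y\<^sub>0\<^sup>2)) \<le> P
       \<and> P \<le> 2 * pi * sqrt (m / (2 * \<sigma> * L\<^sub>0)) / sqrt (1 / L\<^sub>0 - 2 / (L + sqrt (L\<^sup>2 + y\<^sub>0\<^sup>2)))"
proof -
  define k where "k = 2 * \<sigma> / m"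
  define S where "S x = sqrt (L\<^sup>2 + x\<^sup>2)" for x
  have "0 < k" using assms by (simp add: k_def)
  have "0 < L" using assms by simp
  have SL: "L \<le> S x" for x using le_sqrt_sum_squares[OF \<open>0 < L\<close>] by (simp add: S_def)
  obtain v a where v: "\<And>t. (y has_real_derivative v t) (at t)"
    and a: "\<And>t. (v has_real_derivative a t) (at t)"
    and ode: "\<And>t. a t + (2 * \<sigma> / m * ((sqrt (L\<^sup>2 + (y t)\<^sup>2) - L\<^sub>0) / sqrt (L\<^sup>2 + (y t)\<^sup>2))) * y t = 0"
    and init: "y 0 = y\<^sub>0" "v 0 = 0"
    using assms(6) unfolding wire_solution_def by blast
  have "a t = wire_accel k L\<^sub>0 L (y t)" for t
    using ode[of t] unfolding wire_accel_def k_def by linarith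
  then have v': "(v has_real_derivative wire_accel k L\<^sub>0 L (y t)) (at t)" for t using a[of t] by simp
  define \<alpha> where "\<alpha> = sqrt (k * (1 - 2 * L\<^sub>0 / (L + S y\<^sub>0)))"
  define \<beta> where "\<beta> = sqrt (k * (1 - L\<^sub>0 / S y\<^sub>0))"
  have pos: "0 < 1 - 2 * L\<^sub>0 / (L + S y\<^sub>0)" "0 < 1 - L\<^sub>0 / S y\<^sub>0"
    using SL[of y\<^sub>0] assms by (auto simp: field_simps)
  then have "0 < \<alpha>" "0 < \<beta>" using \<open>0 < k\<close> by (simp_all add: \<alpha>_def \<beta>_def)
  have H: "\<alpha>\<^sup>2 \<le> k * (1 - 2 * L\<^sub>0 / (sqrt (L\<^sup>2 + y\<^sub>0\<^sup>2) + sqrt (L\<^sup>2 + x\<^sup>2)))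
      \<and> k * (1 - 2 * L\<^sub>0 / (sqrt (L\<^sup>2 + y\<^sub>0\<^sup>2) + sqrt (L\<^sup>2 + x\<^sup>2))) \<le> \<beta>\<^sup>2"
    if "0 \<le> x" "x \<le> y\<^sub>0" for x
  proof -
    have "S x \<le> S y\<^sub>0" using that by (simp add: S_def power_mono)
    have "0 < S x" using SL[of x] \<open>0 < L\<close> by linarith
    have "2 * L\<^sub>0 / (S y\<^sub>0 + S x) \<le> 2 * L\<^sub>0 / (L + S y\<^sub>0)"
      using SL[of x] SL[of y\<^sub>0] assms by (intro divide_left_mono) (auto intro!: mult_pos_pos)
    moreover have "2 * L\<^sub>0 / (2 * S y\<^sub>0) \<le> 2 * L\<^sub>0 / (S y\<^sub>0 + S x)"
      using \<open>S x \<le> S y\<^sub>0\<close> \<open>0 < S x\<close> assms by (intro divide_left_mono) (auto intro!: mult_pos_pos)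
    ultimately show ?thesis
      unfolding S_def[symmetric] using pos \<open>0 < k\<close>
      by (simp add: \<alpha>_def \<beta>_def)
  qed
  note lip = wire_accel_lipschitz[OF \<open>0 < k\<close> assms(3,4)]
  note neg = wire_accel_neg[OF \<open>0 < k\<close> assms(3,4)]
  obtain T where T: "0 < T" "y T = 0" "\<And>s. 0 \<le> s \<Longrightarrow> s < T \<Longrightarrow> 0 < y s"
    "\<And>s. 0 < s \<Longrightarrow> s \<le> T \<Longrightarrow> y s < y\<^sub>0" "\<alpha> * T \<le> pi / 2" "pi / 2 \<le> \<beta> * T"
    using first_zero[OF v v' init assms(5) neg wire_energy[OF \<open>0 < L\<close> v v' init] H \<open>0 < \<alpha>\<close> \<open>0 < \<beta>\<close>]
    by blast
  have P: "P = 4 * T"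
    by (rule least_period_quarters[OF lip wire_accel_odd v v' init assms(5) T(1-4) assms(7)])
  \<comment> \<open>With \<open>c = 1 / S y\<^sub>0\<close> and \<open>c = 2 / (L + S y\<^sub>0)\<close>, the two bounds of the claim are
    \<open>2 * pi / \<beta>\<close> and \<open>2 * pi / \<alpha>\<close>.\<close>
  have freq: "2 * pi * sqrt (m / (2 * \<sigma> * L\<^sub>0)) / sqrt (1 / L\<^sub>0 - c) = 2 * pi / sqrt (k * (1 - L\<^sub>0 * c))"
    for c
  proof -
    have "m / (2 * \<sigma> * L\<^sub>0) / (1 / L\<^sub>0 - c) = 1 / (k * (1 - L\<^sub>0 * c))"
    proof -
      have "1 / L\<^sub>0 - c = (1 - L\<^sub>0 * c) / L\<^sub>0" using assms by (simp add: field_simps)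
      then show ?thesis using assms by (simp add: k_def)
    qed
    then have "sqrt (m / (2 * \<sigma> * L\<^sub>0)) / sqrt (1 / L\<^sub>0 - c) = 1 / sqrt (k * (1 - L\<^sub>0 * c))"
      by (metis real_sqrt_divide real_sqrt_one)
    then show ?thesis by (metis times_divide_eq_right mult.right_neutral)
  qed
  have "2 * pi / \<beta> \<le> P" "P \<le> 2 * pi / \<alpha>"
    using T(5,6) \<open>0 < \<alpha>\<close> \<open>0 < \<beta>\<close> by (simp_all add: P field_simps)
  then show ?thesis
    using freq[of "1 / S y\<^sub>0"] freq[of "2 / (L + S y\<^sub>0)"]
    by (simp add: \<alpha>_def \<beta>_def S_def[symmetric] mult.commute)
qed

end
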